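(* Let $d>1$, $m\ge 1$ be integers, let $\Lambda\in\mathbb{R}^{d\times d}$ be a nonsingular symmetric matrix, $\Pi\in\mathbb{R}^{d\times m}$ a matrix, $t_0\ge 0$ and $x_0,y_0\in\mathbb{R}^d$. Let $\mathbf{x}(t)=(x(t),y(t))^\top\in\mathbb{R}^{2d}$, $t\ge t_0$, be the solution of the coupled harmonic oscillator $$d\begin{bmatrix}x(t)\\ y(t)\end{bmatrix}=\begin{bmatrix}\mathbf{0}&\mathbf{I}\\ -\Lambda^2&\mathbf{0}\end{bmatrix}\begin{bmatrix}x(t)\\ y(t)\end{bmatrix}dt+\begin{bmatrix}\mathbf{0}\\ \Pi\end{bmatrix}d\mathbf{w}_t,\qquad t\ge t_0,$$ with initial condition $\mathbf{x}(t_0)=(x_0,y_0)^\top$. Then, almost surely, each component of the solution $\mathbf{x}(t)$ has infinitely many zeros on $[t_0,\infty)$, for every $t_0\ge 0$.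
   Context: $\mathbf{I}$ is the $d$-dimensional identity matrix, and $\mathbf{w}_t$ is an $m$-dimensional standard Wiener process on a filtered complete probability space $(\Omega,\mathfrak{F},(\mathfrak{F}_t)_{t\ge t_0},\mathbb{P})$. The vectors $x(t),y(t)$ take values in $\mathbb{R}^d$. *)

theory Defs
  imports "HOL-Probability.Probability"
begin

text \<open>Vectors and matrices in block form: a pair of vectors indexed by \<open>'p\<close> and \<open>'q\<close> is a vector
  indexed by the sum type, with \<open>Inl\<close> and \<open>Inr\<close> selecting the upper and the lower block. The
  entry in row \<open>i\<close> and column \<open>j\<close> of \<open>A\<close> is \<open>A $ i $ j\<close>.\<close>

definition block_vec :: "'a ^ 'p \<Rightarrow> 'a ^ 'q \<Rightarrow> 'a ^ ('p::finite + 'q::finite)" where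
  "block_vec u v = (\<chi> k. case k of Inl i \<Rightarrow> u $ i | Inr i \<Rightarrow> v $ i)"

definition block_col :: "'a ^ 'n ^ 'p \<Rightarrow> 'a ^ 'n ^ 'q \<Rightarrow> 'a ^ 'n ^ ('p::finite + 'q::finite)" where
  "block_col A B = (\<chi> k. case k of Inl i \<Rightarrow> A $ i | Inr i \<Rightarrow> B $ i)"

definition block_mat ::
  "'a ^ 'm ^ 'p \<Rightarrow> 'a ^ 'n ^ 'p \<Rightarrow> 'a ^ 'm ^ 'q \<Rightarrow> 'a ^ 'n ^ 'q
    \<Rightarrow> 'a ^ ('m::finite + 'n::finite) ^ ('p::finite + 'q::finite)" where
  "block_mat A B C D =
     (\<chi> k. case k of Inl i \<Rightarrow> block_vec (A $ i) (B $ i) | Inr i \<Rightarrow> block_vec (C $ i) (D $ i))"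

definition filtration_from :: "'w measure \<Rightarrow> real \<Rightarrow> (real \<Rightarrow> 'w measure) \<Rightarrow> bool" where
  "filtration_from M t0 F \<longleftrightarrow>
     (\<forall>t\<ge>t0. subalgebra M (F t)) \<and> (\<forall>s\<ge>t0. \<forall>t\<ge>s. sets (F s) \<subseteq> sets (F t))"

definition adapted_from ::
  "real \<Rightarrow> (real \<Rightarrow> 'w measure) \<Rightarrow> (real \<Rightarrow> 'w \<Rightarrow> 'b::topological_space) \<Rightarrow> bool" where
  "adapted_from t0 F X \<longleftrightarrow> (\<forall>t\<ge>t0. X t \<in> borel_measurable (F t))"

text \<open>The density in the third clause is that of the normal distribution on \<open>real ^ 'm\<close> with mean
  \<open>0\<close> and covariance matrix \<open>(t - s) *\<^sub>R mat 1\<close>; the second argument of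
  \<open>normal_density\<close> is the standard deviation.\<close>

definition standard_wiener :: "'w measure \<Rightarrow> (real \<Rightarrow> 'w \<Rightarrow> real ^ 'm) \<Rightarrow> bool" where
  "standard_wiener M w \<longleftrightarrow>
     (\<forall>t\<ge>0. w t \<in> borel_measurable M) \<and>
     (AE \<omega> in M. w 0 \<omega> = 0) \<and>
     (\<forall>s\<ge>0. \<forall>t>s. distributed M lborel (\<lambda>\<omega>. w t \<omega> - w s \<omega>)
        (\<lambda>v. ennreal (\<Prod>i\<in>UNIV. normal_density 0 (sqrt (t - s)) (v $ i)))) \<and>
     (\<forall>n (\<tau> :: nat \<Rightarrow> real). 0 \<le> \<tau> 0 \<longrightarrow> strict_mono_on {..n} \<tau> \<longrightarrow>
        prob_space.indep_vars M (\<lambda>_. borel) (\<lambda>k \<omega>. w (\<tau> (Suc k)) \<omega> - w (\<tau> k) \<omega>) {..<n}) \<and>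
     (AE \<omega> in M. continuous_on {0..} (\<lambda>t. w t \<omega>))"

text \<open>A standard Wiener process is given on \<open>{0..}\<close>, whereas the filtration is indexed by
  \<open>{t0..}\<close>, so the compatibility of the two is only required from \<open>t0\<close> on.\<close>

definition wiener_wrt ::
  "'w measure \<Rightarrow> real \<Rightarrow> (real \<Rightarrow> 'w measure) \<Rightarrow> (real \<Rightarrow> 'w \<Rightarrow> real ^ 'm) \<Rightarrow> bool" where
  "wiener_wrt M t0 F w \<longleftrightarrow>
     standard_wiener M w \<and> adapted_from t0 F w \<and>
     (\<forall>s\<ge>t0. \<forall>t>s. prob_space.indep_set M (sets (F s))
        (sets (vimage_algebra (space M) (\<lambda>\<omega>. w t \<omega> - w s \<omega>) borel)))"

text \<open>Strong solutions on \<open>{t0..}\<close> of the linear equation with additive noise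
  \<open>dX = A X dt + G dw\<close>. As usual the differential notation stands for the integral equation; the
  integrand \<open>G\<close> of the Ito integral is constant, so that the integral over \<open>{t0..t}\<close> is
  the increment \<open>G *v (w t - w t0)\<close>.\<close>

definition linear_sde_solution ::
  "'w measure \<Rightarrow> real \<Rightarrow> (real \<Rightarrow> 'w measure) \<Rightarrow> (real \<Rightarrow> 'w \<Rightarrow> real ^ 'm) \<Rightarrow>
    real ^ 'n ^ 'n \<Rightarrow> real ^ 'm ^ 'n \<Rightarrow> (real \<Rightarrow> 'w \<Rightarrow> real ^ 'n) \<Rightarrow> bool" where
  "linear_sde_solution M t0 F w A G X \<longleftrightarrow>
     adapted_from t0 F X \<and>
     (AE \<omega> in M. continuous_on {t0..} (\<lambda>t. X t \<omega>)) \<and>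
     (AE \<omega> in M. \<forall>t\<ge>t0.
        X t \<omega> = X t0 \<omega> + integral {t0..t} (\<lambda>s. A *v X s \<omega>) + G *v (w t \<omega> - w t0 \<omega>))"

end

theory Submission
  imports Defs
begin

text \<open>In a basis of eigenvectors of \<open>\<Lambda>\<close> the system decouples into forced oscillators with nonzero
  frequencies \<open>c\<close>, and a component \<open>u\<close> of the solution is a finite linear combination of their
  positions or velocities. Since \<open>u(t) + u(t + pi / \<bar>c\<bar>)\<close> eliminates the free oscillation of
  frequency \<open>c\<close>, summing \<open>u(t + \<tau>)\<close> over all subset sums \<open>\<tau>\<close> of the half periods eliminates the
  initial data: what remains is a linear functional of the increments of \<open>w\<close> on \<open>[t, t + L]\<close>, where
  \<open>L\<close> is the sum of the half periods. The values of this functional at \<open>t\<close>, \<open>t + L\<close>, \<open>t + 2 L\<close>, \<dots>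
  are independent and symmetrically distributed, so almost surely they are not all positive.
  But if \<open>u\<close> had only finitely many zeros, it would eventually have constant sign, and then so
  would the functional. No stochastic integral is needed: the functional is a pathwise limit of
  finite linear combinations of increments, and the bound \<open>2 ^ -m\<close> for the probability of \<open>m\<close>
  positive values passes to the limit.\<close>

subsection \<open>Symmetric independent increments\<close>

lemma lborel_distr_uminus_euclidean:
  "distr lborel borel uminus = (lborel :: 'a::euclidean_space measure)"
  by (subst lborel_affine[of "-1" 0]) (auto simp: density_1 one_ennreal_def[symmetric])

text \<open>Lebesgue measure is invariant under reflection, so a law with an even density is
  invariant too.\<close>

lemma (in prob_space) distr_uminus_eq_if_even_density:
  fixes X :: "'a \<Rightarrow> 'b::euclidean_space"
  assumes D: "distributed M lborel X f" and even: "\<And>v. f (- v) = f v"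
  shows "distr M borel (\<lambda>\<omega>. - X \<omega>) = distr M borel X"
proof -
  have X[measurable]: "X \<in> borel_measurable M" and f[measurable]: "f \<in> borel_measurable lborel"
    and eq: "distr M lborel X = density lborel f"
    using D by (auto simp: distributed_def)
  have bX: "distr M borel X = density lborel f"
    using eq by (simp cong: distr_cong)
  have "distr M borel (\<lambda>\<omega>. - X \<omega>) = distr (distr M borel X) borel uminus"
    by (subst distr_distr) (auto simp: comp_def)
  also have "\<dots> = distr (density lborel (\<lambda>x. f (- x))) borel uminus"
    by (simp add: bX even)
  also have "\<dots> = density (distr lborel borel uminus) f"
    by (subst density_distr) (auto simp: comp_def)
  also have "\<dots> = distr M borel X"
    by (simp add: lborel_distr_uminus_euclidean bX)
  finally show ?thesis .
qed

text \<open>By independence the joint law is the product of the marginals, so changing all signs at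
  once preserves it. The sum is therefore positive and negative with equal probability, and these
  events are disjoint. Only an inequality results, since the sum may vanish with positive
  probability.\<close>

lemma (in prob_space) prob_indep_symmetric_sum_pos_le_half:
  fixes D :: "'i \<Rightarrow> 'a \<Rightarrow> 'v::euclidean_space"
  assumes ind: "indep_vars (\<lambda>_. borel) D B" and B: "finite B"
    and sym: "\<And>k. k \<in> B \<Longrightarrow> distr M borel (\<lambda>\<omega>. - D k \<omega>) = distr M borel (D k)"
  shows "prob {\<omega> \<in> space M. (\<Sum>k\<in>B. c k \<bullet> D k \<omega>) > 0} \<le> 1/2"
proof (cases "B = {}")
  case False
  have rv[measurable]: "k \<in> B \<Longrightarrow> D k \<in> borel_measurable M" for k
    using ind by (auto simp: indep_vars_def)
  let ?P = "PiM B (\<lambda>_. borel :: 'v measure)"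
  let ?J = "\<lambda>\<omega>. \<lambda>k\<in>B. D k \<omega>" and ?J' = "\<lambda>\<omega>. \<lambda>k\<in>B. - D k \<omega>"
  have J[measurable]: "?J \<in> measurable M ?P" "?J' \<in> measurable M ?P"
    by (auto intro!: measurable_restrict)
  have ind': "indep_vars (\<lambda>_. borel) (\<lambda>k \<omega>. - D k \<omega>) B"
    using indep_vars_compose2[OF ind, of "\<lambda>_ x. - x" "\<lambda>_. borel"] by simp
  have "distr M ?P ?J' = PiM B (\<lambda>k. distr M borel (\<lambda>\<omega>. - D k \<omega>))"
    using ind' indep_vars_iff_distr_eq_PiM'[OF False, of "\<lambda>k \<omega>. - D k \<omega>" "\<lambda>_. borel"] by simp
  also have "\<dots> = PiM B (\<lambda>k. distr M borel (D k))"
    by (intro PiM_cong) (auto simp: sym)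
  also have "\<dots> = distr M ?P ?J"
    using ind indep_vars_iff_distr_eq_PiM'[OF False, of D "\<lambda>_. borel"] by simp
  finally have eq: "distr M ?P ?J' = distr M ?P ?J" .
  let ?A = "{x \<in> space ?P. (\<Sum>k\<in>B. c k \<bullet> x k) > 0}"
  let ?V = "\<lambda>\<omega>. \<Sum>k\<in>B. c k \<bullet> D k \<omega>"
  have A[measurable]: "?A \<in> sets ?P" by measurable
  have "prob {\<omega> \<in> space M. ?V \<omega> < 0} = measure (distr M ?P ?J') ?A"
    by (subst measure_distr[OF J(2) A])
       (auto intro!: arg_cong[where f=prob] simp: sum_negf space_PiM)
  also have "\<dots> = prob {\<omega> \<in> space M. ?V \<omega> > 0}"
    unfolding eq by (subst measure_distr[OF J(1) A])
       (auto intro!: arg_cong[where f=prob] simp: space_PiM)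
  finally have "2 * prob {\<omega> \<in> space M. ?V \<omega> > 0}
      = prob {\<omega> \<in> space M. ?V \<omega> > 0} + prob {\<omega> \<in> space M. ?V \<omega> < 0}" by simp
  also have "\<dots> = prob ({\<omega> \<in> space M. ?V \<omega> > 0} \<union> {\<omega> \<in> space M. ?V \<omega> < 0})"
    by (subst finite_measure_Union) auto
  also have "\<dots> \<le> 1" by simp
  finally show ?thesis by simp
qed simp

text \<open>Sums over disjoint blocks of an independent family are again independent, so the bounds
  1/2 of the single blocks multiply.\<close>

lemma (in prob_space) prob_indep_symmetric_blocks_pos_le:
  fixes D :: "'i \<Rightarrow> 'a \<Rightarrow> 'v::euclidean_space"
  assumes ind: "indep_vars (\<lambda>_. borel) D I" and I: "finite I"
    and sym: "\<And>k. k \<in> I \<Longrightarrow> distr M borel (\<lambda>\<omega>. - D k \<omega>) = distr M borel (D k)"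
    and disj: "disjoint_family_on B {..<m}" and sub: "\<And>n. n < m \<Longrightarrow> B n \<subseteq> I"
  shows "prob {\<omega> \<in> space M. \<forall>n<m. (\<Sum>k\<in>B n. c n k \<bullet> D k \<omega>) > 0} \<le> (1/2) ^ m"
proof (cases "m = 0")
  case False
  let ?V = "\<lambda>n \<omega>. \<Sum>k\<in>B n. c n k \<bullet> D k \<omega>"
  have "indep_vars (\<lambda>n. PiM (B n) (\<lambda>_. borel)) (\<lambda>n \<omega>. \<lambda>k\<in>B n. D k \<omega>) {..<m}"
    using sub by (intro indep_vars_restrict[OF ind _ disj]) auto
  then have "indep_vars (\<lambda>_. borel) (\<lambda>n \<omega>. (\<lambda>x. \<Sum>k\<in>B n. c n k \<bullet> x k) (\<lambda>k\<in>B n. D k \<omega>)) {..<m}"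
    by (rule indep_vars_compose2) measurable
  then have V: "indep_vars (\<lambda>_. borel) ?V {..<m}"
    by simp
  have "{\<omega> \<in> space M. \<forall>n<m. ?V n \<omega> > 0} = (\<Inter>n\<in>{..<m}. ?V n -` {0<..} \<inter> space M)"
    using False by auto
  also have "prob \<dots> = (\<Prod>n<m. prob (?V n -` {0<..} \<inter> space M))"
    using False by (intro indep_varsD_finite[OF V]) auto
  also have "\<dots> \<le> (\<Prod>n<m. 1/2)"
  proof (rule prod_mono, safe)
    fix n assume n: "n < m"
    have "prob {\<omega> \<in> space M. ?V n \<omega> > 0} \<le> 1/2"
      using sub[OF n] I by (intro prob_indep_symmetric_sum_pos_le_half indep_vars_subset[OF ind] sym)
        (auto intro: finite_subset)
    then show "prob (?V n -` {0<..} \<inter> space M) \<le> 1/2"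
      by (simp add: vimage_def Int_def conj_commute)
  qed auto
  finally show ?thesis by simp
qed simp

section \<open>Increments of a Wiener process on consecutive windows\<close>

lemma ex_strict_mono_enumeration:
  fixes T :: "'a::linorder set"
  assumes "finite T" "T \<noteq> {}"
  obtains \<tau> :: "nat \<Rightarrow> 'a" and q where "strict_mono_on {..q} \<tau>" "\<tau> ` {..q} = T"
proof
  let ?l = "sorted_list_of_set T" and ?q = "card T - 1"
  have len: "length ?l = Suc ?q"
    using assms by (simp add: card_gt_0_iff)
  show "strict_mono_on {..?q} (\<lambda>k. ?l ! k)"
    using len by (intro strict_mono_onI) 
      (auto intro!: sorted_wrt_nth_less[OF strict_sorted_list_of_set])
  have "(\<lambda>k. ?l ! k) ` {..?q} = set ?l"
    unfolding set_conv_nth len by (auto simp: less_Suc_eq_le)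
  then show "(\<lambda>k. ?l ! k) ` {..?q} = T"
    using assms by simp
qed

text \<open>A list entry \<open>(r, b)\<close> stands for the evaluation
  \<open>b \<bullet> f r\<close>. The sampling times of all windows are merged into one increasing
  sequence \<open>\<tau>\<close>. Each window value is then a combination of elementary increments
  inside its own window, and distinct windows use disjoint sets of these independent
  increments.\<close>

lemma standard_wiener_blocks_pos_le:
  fixes w :: "real \<Rightarrow> 'w \<Rightarrow> real ^ 'm" and xs :: "(real \<times> (real ^ 'm)) list"
  assumes M: "prob_space M" and w: "standard_wiener M w"
    and s: "s \<ge> 0" and L: "L > 0" and xs: "fst ` set xs \<subseteq> {0..L}"
  shows "measure M {\<omega> \<in> space M. \<forall>n<m.
      (\<Sum>(r, b)\<leftarrow>xs. b \<bullet> (w (s + real n * L + r) \<omega> - w (s + real n * L) \<omega>)) > 0} \<le> (1/2) ^ m"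
proof -
  interpret prob_space M by fact
  let ?s = "\<lambda>n. s + real n * L"
  \<comment> \<open>The offset \<open>0\<close> puts every window start into \<open>T\<close>, so
    that increments within a window telescope from there.\<close>
  let ?R = "insert 0 (insert L (fst ` set xs))"
  define T where "T = (\<lambda>(n, r). ?s n + r) ` ({..m} \<times> ?R)"
  have T: "finite T" "T \<noteq> {}" by (auto simp: T_def)
  obtain \<tau> :: "nat \<Rightarrow> real" and q where \<tau>: "strict_mono_on {..q} \<tau>" and \<tau>T: "\<tau> ` {..q} = T"
    by (rule ex_strict_mono_enumeration[OF T])
  have T0: "t \<ge> 0" if "t \<in> T" for t
    using that s L xs by (auto simp: T_def)
  have TI: "?s n + r \<in> T" if "n < m" "r \<in> ?R" for n r
    using that unfolding T_def by (auto intro!: image_eqI[where x="(n, r)"])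
  have less: "\<tau> i < \<tau> j \<longleftrightarrow> i < j" if "i \<le> q" "j \<le> q" for i j
    using strict_mono_on_less[OF \<tau>] that by simp
  have \<tau>0: "\<tau> k \<ge> 0" if "k \<le> q" for k
    using that T0 \<tau>T by blast
  let ?D = "\<lambda>k \<omega>. w (\<tau> (Suc k)) \<omega> - w (\<tau> k) \<omega>"
  \<comment> \<open>The elementary increments that start in window \<open>n\<close>; the window is
    half-open, so that neighbouring windows share none.\<close>
  define B where "B n = {k. k < q \<and> ?s n \<le> \<tau> k \<and> \<tau> k < ?s (Suc n)}" for n
  have ind: "indep_vars (\<lambda>_. borel) ?D {..<q}"
    using w \<tau> \<tau>0[of 0] by (auto simp: standard_wiener_def)
  have sym: "distr M borel (\<lambda>\<omega>. - ?D k \<omega>) = distr M borel (?D k)" if "k \<in> {..<q}" for k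
  proof (rule distr_uminus_eq_if_even_density)
    have "\<tau> k < \<tau> (Suc k)" using less[of k "Suc k"] that by auto
    with \<tau>0[of k] that w show "distributed M lborel (?D k)
       (\<lambda>v. ennreal (\<Prod>i\<in>UNIV. normal_density 0 (sqrt (\<tau> (Suc k) - \<tau> k)) (v $ i)))"
      by (auto simp: standard_wiener_def)
  qed (simp add: normal_density_def)
  have disj: "disjoint_family_on B {..<m}"
  proof -
    have "?s (Suc a) \<le> ?s b" if "a < b" for a b
      using that L mult_right_mono[of "real (Suc a)" "real b" L] by simp
    then have "B a \<inter> B b = {}" if "a < b" for a b
      using that by (fastforce simp: B_def)
    then show ?thesis
      unfolding disjoint_family_on_def by (metis Int_commute linorder_neqE_nat)
  qed
  \<comment> \<open>The increment telescopes along \<open>\<tau>\<close>. Writing it as a sum over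
    all of \<open>B n\<close> with a cutoff gives all offsets \<open>r\<close> the same index
    set.\<close>
  have incr: "w (?s n + r) \<omega> - w (?s n) \<omega> = (\<Sum>k\<in>B n. if \<tau> k < ?s n + r then ?D k \<omega> else 0)"
    if n: "n < m" and r: "r \<in> ?R" for n r \<omega>
  proof -
    obtain i where i: "i \<le> q" "\<tau> i = ?s n"
      using TI[OF n, of 0] \<tau>T by fastforce
    obtain j where j: "j \<le> q" "\<tau> j = ?s n + r"
      using TI[OF n r] \<tau>T by fastforce
    have rr: "0 \<le> r" "r \<le> L" using r L xs by auto
    have ij: "i \<le> j" using less[OF j(1) i(1)] i j rr by linarith
    have "w (?s n + r) \<omega> - w (?s n) \<omega> = (\<Sum>k=i..<j. ?D k \<omega>)"
      using sum_Suc_diff'[OF ij, of "\<lambda>k. w (\<tau> k) \<omega>"] by (simp add: i j)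
    also have "{i..<j} = {k \<in> B n. \<tau> k < ?s n + r}"
    proof (intro set_eqI)
      fix k
      have "k \<in> B n \<and> \<tau> k < ?s n + r \<longleftrightarrow> k < q \<and> \<not> \<tau> k < \<tau> i \<and> \<tau> k < \<tau> j"
        using rr by (auto simp: B_def i j algebra_simps)
      also have "\<dots> \<longleftrightarrow> i \<le> k \<and> k < j"
        using less[OF _ i(1), of k] less[OF _ j(1), of k] j(1) by auto
      finally show "k \<in> {i..<j} \<longleftrightarrow> k \<in> {k \<in> B n. \<tau> k < ?s n + r}" by simp
    qed
    also have "(\<Sum>k\<in>\<dots>. ?D k \<omega>) = (\<Sum>k\<in>B n. if \<tau> k < ?s n + r then ?D k \<omega> else 0)"
      by (rule sum.inter_filter) (simp add: B_def)
    finally show ?thesis .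
  qed
  \<comment> \<open>An elementary increment gets the vectors \<open>b\<close> of all list entries
    whose interval from the window start reaches beyond \<open>\<tau> k\<close>.\<close>
  define c where "c n k = (\<Sum>(r, b)\<leftarrow>xs. if \<tau> k < ?s n + r then b else 0)" for n k
  have V: "(\<Sum>(r, b)\<leftarrow>xs. b \<bullet> (w (?s n + r) \<omega> - w (?s n) \<omega>)) = (\<Sum>k\<in>B n. c n k \<bullet> ?D k \<omega>)"
    if n: "n < m" for n \<omega>
  proof -
    have "(\<Sum>(r, b)\<leftarrow>ys. b \<bullet> (w (?s n + r) \<omega> - w (?s n) \<omega>))
        = (\<Sum>k\<in>B n. (\<Sum>(r, b)\<leftarrow>ys. if \<tau> k < ?s n + r then b else 0) \<bullet> ?D k \<omega>)"
      if "set ys \<subseteq> set xs" for ys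
      using that
    proof (induction ys)
      case (Cons a ys)
      obtain r b where a: "a = (r, b)" by force
      have "r \<in> ?R" using Cons.prems by (force simp: a)
      from incr[OF n this, of \<omega>] show ?case
        using Cons by (simp add: a inner_add_left sum.distrib inner_sum_right)
          (auto intro!: sum.cong)
    qed simp
    from this[of xs] show ?thesis by (simp add: c_def)
  qed
  have "{\<omega> \<in> space M. \<forall>n<m. (\<Sum>(r, b)\<leftarrow>xs. b \<bullet> (w (?s n + r) \<omega> - w (?s n) \<omega>)) > 0}
      = {\<omega> \<in> space M. \<forall>n<m. (\<Sum>k\<in>B n. c n k \<bullet> ?D k \<omega>) > 0}"
    using V by auto
  also have "prob \<dots> \<le> (1/2) ^ m"
    by (rule prob_indep_symmetric_blocks_pos_le[OF ind _ sym disj]) (auto simp: B_def)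
  finally show ?thesis .
qed

subsection \<open>Pathwise limits of finite linear functionals\<close>

lemma left_riemann_sums_tendsto:
  fixes h :: "real \<Rightarrow> real"
  assumes h: "continuous_on {0..a} h" and a: "a \<ge> 0"
  shows "(\<lambda>N. \<Sum>i<N. a / real N * h (real i * a / real N)) \<longlonglongrightarrow> integral {0..a} h"
proof (cases "a = 0")
  case False
  with a have a: "a > 0" by simp
  have ucont: "uniformly_continuous_on {0..a} h"
    using h by (intro compact_uniformly_continuous) auto
  show ?thesis
  proof (rule LIMSEQ_I)
    fix e :: real assume e: "e > 0"
    \<comment> \<open>Chosen so that \<open>N\<close> errors of size
      \<open>e' * (a / real N)\<close> add up to \<open>e / 2\<close>.\<close>
    define e' where "e' = e / (2 * a)"
    have e': "e' > 0" using e a by (simp add: e'_def)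
    obtain d where d: "d > 0"
      and dh: "\<And>x y. x \<in> {0..a} \<Longrightarrow> y \<in> {0..a} \<Longrightarrow> dist y x < d \<Longrightarrow> dist (h y) (h x) < e'"
      using ucont e' unfolding uniformly_continuous_on_def by metis
    obtain N0 :: nat where N0: "a / d < real N0" using reals_Archimedean2 by blast
    show "\<exists>N0. \<forall>N\<ge>N0. norm ((\<Sum>i<N. a / real N * h (real i * a / real N)) - integral {0..a} h) < e"
    proof (intro exI allI impI)
      fix N assume N: "N \<ge> N0"
      have Nd: "a / d < real N" using N N0 by linarith
      have N0: "real N > 0" using Nd a d by (meson divide_pos_pos less_trans)
      let ?\<delta> = "a / real N"
      have \<delta>d: "?\<delta> < d" using Nd N0 d by (simp add: field_simps)
      have \<delta>0: "?\<delta> > 0" using a N0 by simp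
      let ?F = "\<lambda>t. integral {0..t} h"
      let ?p = "\<lambda>i. real i * ?\<delta>"
      have step: "\<bar>?\<delta> * h (?p i) - (?F (?p (Suc i)) - ?F (?p i))\<bar> \<le> e' * ?\<delta>" if i: "i < N" for i
      proof -
        have pi: "0 \<le> ?p i" "?p i \<le> ?p (Suc i)" using a by (auto intro!: divide_right_mono mult_right_mono)
        have "real (Suc i) * ?\<delta> \<le> real N * ?\<delta>" using i \<delta>0 by (intro mult_right_mono) auto
        then have pa: "?p (Suc i) \<le> a" using N0 by simp
        have hint: "h integrable_on {u..v}" if "0 \<le> u" "v \<le> a" for u v
          using that by (intro integrable_continuous_real continuous_on_subset[OF h]) auto
        have "?F (?p (Suc i)) - ?F (?p i) = integral {?p i..?p (Suc i)} h"
          using Henstock_Kurzweil_Integration.integral_combine[OF pi hint] pa by simp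
        moreover have "integral {?p i..?p (Suc i)} (\<lambda>_. h (?p i)) = ?\<delta> * h (?p i)"
          using pi by (simp add: content_real algebra_simps add_divide_distrib)
        ultimately have "?\<delta> * h (?p i) - (?F (?p (Suc i)) - ?F (?p i))
            = integral {?p i..?p (Suc i)} (\<lambda>r. h (?p i) - h r)"
          using hint pi pa by (subst Henstock_Kurzweil_Integration.integral_diff) auto
        also have "norm \<dots> \<le> e' * (?p (Suc i) - ?p i)"
        proof (rule integral_bound)
          show "continuous_on {?p i..?p (Suc i)} (\<lambda>r. h (?p i) - h r)"
            using pi pa by (intro continuous_intros continuous_on_subset[OF h]) auto
          fix r assume r: "r \<in> {?p i..?p (Suc i)}"
          have "dist (?p i) r < d" using r \<delta>d by (simp add: dist_real_def algebra_simps add_divide_distrib)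
          then have "dist (h (?p i)) (h r) < e'"
            using r pi pa by (intro dh) auto
          then show "norm (h (?p i) - h r) \<le> e'" by (simp add: dist_norm)
        qed (use pi in auto)
        also have "e' * (?p (Suc i) - ?p i) = e' * ?\<delta>" by (simp add: algebra_simps add_divide_distrib)
        finally show ?thesis by simp
      qed
      have "integral {0..a} h = (\<Sum>i<N. ?F (?p (Suc i)) - ?F (?p i))"
        using N0 by (subst sum_lessThan_telescope) auto
      then have "\<bar>(\<Sum>i<N. ?\<delta> * h (?p i)) - integral {0..a} h\<bar>
          = \<bar>\<Sum>i<N. ?\<delta> * h (?p i) - (?F (?p (Suc i)) - ?F (?p i))\<bar>"
        by (simp add: sum_subtractf)
      also have "\<dots> \<le> (\<Sum>i<N. e' * ?\<delta>)"
        by (rule order_trans[OF sum_abs sum_mono]) (use step in auto)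
      also have "\<dots> = e / 2" using N0 a by (simp add: e'_def)
      finally show "norm ((\<Sum>i<N. a / real N * h (real i * a / real N)) - integral {0..a} h) < e"
        using e by simp
    qed
  qed
qed simp

text \<open>The lists do not depend on \<open>f\<close>. Inserting a random continuous path
  therefore yields random variables that are finite combinations of its values and converge
  pathwise.\<close>

definition limit_of_evaluations :: "real \<Rightarrow> ((real \<Rightarrow> 'v::real_inner) \<Rightarrow> real) \<Rightarrow> bool" where
  "limit_of_evaluations L \<Phi> \<longleftrightarrow>
     (\<exists>xs :: nat \<Rightarrow> (real \<times> 'v) list. (\<forall>N. fst ` set (xs N) \<subseteq> {0..L}) \<and>
        (\<forall>f. continuous_on {0..L} f \<longrightarrow> (\<lambda>N. \<Sum>(r, b)\<leftarrow>xs N. b \<bullet> f r) \<longlonglongrightarrow> \<Phi> f))"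

lemma limit_of_evaluations_eval:
  "0 \<le> a \<Longrightarrow> a \<le> L \<Longrightarrow> limit_of_evaluations L (\<lambda>f. q \<bullet> f a)"
  unfolding limit_of_evaluations_def by (rule exI[of _ "\<lambda>_. [(a, q)]"]) auto

lemma limit_of_evaluations_zero: "limit_of_evaluations L (\<lambda>f. 0)"
  unfolding limit_of_evaluations_def by (rule exI[of _ "\<lambda>_. []"]) auto

lemma limit_of_evaluations_add:
  assumes "limit_of_evaluations L \<Phi>" "limit_of_evaluations L \<Psi>"
  shows "limit_of_evaluations L (\<lambda>f. \<Phi> f + \<Psi> f)"
proof -
  from assms obtain xs ys
    where "\<And>N. fst ` set (xs N) \<subseteq> {0..L}" "\<And>N. fst ` set (ys N) \<subseteq> {0..L}"
      "\<And>f. continuous_on {0..L} f \<Longrightarrow> (\<lambda>N. \<Sum>(r, b)\<leftarrow>xs N. b \<bullet> f r) \<longlonglongrightarrow> \<Phi> f"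
      "\<And>f. continuous_on {0..L} f \<Longrightarrow> (\<lambda>N. \<Sum>(r, b)\<leftarrow>ys N. b \<bullet> f r) \<longlonglongrightarrow> \<Psi> f"
    unfolding limit_of_evaluations_def by metis
  then show ?thesis unfolding limit_of_evaluations_def
    by (intro exI[of _ "\<lambda>N. xs N @ ys N"] conjI allI impI) (simp_all add: image_Un tendsto_add)
qed

lemma limit_of_evaluations_cmult:
  assumes "limit_of_evaluations L \<Phi>"
  shows "limit_of_evaluations L (\<lambda>f. c * \<Phi> f)"
proof -
  from assms obtain xs
    where xs: "\<And>N. fst ` set (xs N) \<subseteq> {0..L}"
      "\<And>f. continuous_on {0..L} f \<Longrightarrow> (\<lambda>N. \<Sum>(r, b)\<leftarrow>xs N. b \<bullet> f r) \<longlonglongrightarrow> \<Phi> f"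
    unfolding limit_of_evaluations_def by metis
  have "(\<Sum>(r, b)\<leftarrow>map (\<lambda>(r, b). (r, c *\<^sub>R b)) ys. b \<bullet> f r) = c * (\<Sum>(r, b)\<leftarrow>ys. b \<bullet> f r)"
    for f and ys :: "(real \<times> 'a) list"
    by (induction ys) (auto simp: algebra_simps)
  with xs show ?thesis unfolding limit_of_evaluations_def
    by (intro exI[of _ "\<lambda>N. map (\<lambda>(r, b). (r, c *\<^sub>R b)) (xs N)"]) 
      (auto simp: image_subset_iff case_prod_unfold intro!: tendsto_mult_left)
qed

lemma limit_of_evaluations_diff:
  assumes "limit_of_evaluations L \<Phi>" "limit_of_evaluations L \<Psi>"
  shows "limit_of_evaluations L (\<lambda>f. \<Phi> f - \<Psi> f)"
  using limit_of_evaluations_add[OF assms(1) limit_of_evaluations_cmult[OF assms(2), of "- 1"]] by simp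

lemma limit_of_evaluations_sum:
  "finite A \<Longrightarrow> (\<And>a. a \<in> A \<Longrightarrow> limit_of_evaluations L (\<Phi> a)) \<Longrightarrow>
    limit_of_evaluations L (\<lambda>f. \<Sum>a\<in>A. \<Phi> a f)"
  by (induction A rule: finite_induct)
    (auto intro: limit_of_evaluations_zero limit_of_evaluations_add)

lemma limit_of_evaluations_sum_list:
  "(\<And>a. a \<in> set as \<Longrightarrow> limit_of_evaluations L (\<Phi> a)) \<Longrightarrow>
    limit_of_evaluations L (\<lambda>f. \<Sum>a\<leftarrow>as. \<Phi> a f)"
  by (induction as) (auto intro: limit_of_evaluations_zero limit_of_evaluations_add)

text \<open>Nodes and weights are those of left Riemann sums; they are determined by
  \<open>a\<close>, \<open>g\<close> and \<open>p\<close>, so one sequence serves every continuous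
  \<open>f\<close>.\<close>

lemma limit_of_evaluations_integral:
  assumes a: "0 \<le> a" "a \<le> L" and g: "continuous_on {0..a} g"
  shows "limit_of_evaluations L (\<lambda>f. integral {0..a} (\<lambda>r. g r * (p \<bullet> f r)))"
  unfolding limit_of_evaluations_def
proof (intro exI conjI allI impI)
  let ?xs = "\<lambda>N. map (\<lambda>i. (real i * a / real N, (a / real N * g (real i * a / real N)) *\<^sub>R p)) [0..<N]"
  fix N
  have "real i * a / real N \<le> L" if "i < N" for i
  proof -
    have "real i * a / real N \<le> real N * a / real N"
      using that a by (intro divide_right_mono mult_right_mono) auto
    then show ?thesis using that a by simp
  qed
  then show "fst ` set (?xs N) \<subseteq> {0..L}"
    using a by (auto simp: image_subset_iff)
next
  let ?xs = "\<lambda>N. map (\<lambda>i. (real i * a / real N, (a / real N * g (real i * a / real N)) *\<^sub>R p)) [0..<N]"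
  fix f :: "real \<Rightarrow> 'a" assume f: "continuous_on {0..L} f"
  have "continuous_on {0..a} (\<lambda>r. g r * (p \<bullet> f r))"
    using a by (intro continuous_intros g continuous_on_subset[OF f]) auto
  from left_riemann_sums_tendsto[OF this a(1)]
  show "(\<lambda>N. \<Sum>(r, b)\<leftarrow>?xs N. b \<bullet> f r) \<longlonglongrightarrow> integral {0..a} (\<lambda>r. g r * (p \<bullet> f r))"
    by (simp add: interv_sum_list_conv_sum_set_nat atLeast0LessThan mult.assoc o_def)
qed

subsection \<open>Eigenvectors and forced oscillators\<close>

lemma symmetric_matrix_span_eigenvectors:
  fixes A :: "real ^ 'd ^ 'd"
  assumes sym: "transpose A = A"
  shows "span {v. \<exists>c. A *v v = c *\<^sub>R v} = UNIV"
proof (rule ccontr)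
  let ?E = "{v. \<exists>c. A *v v = c *\<^sub>R v}"
  assume "span ?E \<noteq> UNIV"
  from span_not_UNIV_orthogonal[OF this] obtain a where a: "a \<noteq> 0" "\<And>e. e \<in> ?E \<Longrightarrow> a \<bullet> e = 0"
    by (meson span_base)
  \<comment> \<open>The Rayleigh quotient attains its maximum on the orthogonal complement \<open>W\<close> of all eigenvectors,
    and a maximiser would be an eigenvector.\<close>
  define W where "W = {x. \<forall>e\<in>?E. x \<bullet> e = 0}"
  have W: "subspace W" by (auto simp: W_def subspace_def inner_left_distrib)
  have W_eq: "W = (\<Inter>e\<in>?E. {x. x \<bullet> e = 0})" by (auto simp: W_def)
  have "closed W" unfolding W_eq
    by (intro closed_INT ballI closed_Collect_eq continuous_intros)
  then have comp: "compact (W \<inter> sphere 0 1)" by (simp add: closed_Int_compact)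
  have self: "(A *v x) \<bullet> y = x \<bullet> (A *v y)" for x y
    by (metis dot_lmul_matrix sym vector_transpose_matrix)
  have inv: "A *v x \<in> W" if "x \<in> W" for x
    using that by (auto simp: W_def self)
  have "(1 / norm a) *\<^sub>R a \<in> W \<inter> sphere 0 1"
    using a by (auto simp: W_def)
  then have ne: "W \<inter> sphere 0 1 \<noteq> {}" by blast
  have cont: "continuous_on (W \<inter> sphere 0 1) (\<lambda>x. (A *v x) \<bullet> x)"
    by (intro continuous_intros matrix_vector_mult_linear_continuous_on)
  from continuous_attains_sup[OF comp ne cont]
  obtain v where v': "v \<in> W \<inter> sphere 0 1"
    and vmax': "\<forall>x\<in>W \<inter> sphere 0 1. (A *v x) \<bullet> x \<le> (A *v v) \<bullet> v"
    by blast
  from v' have v: "v \<in> W" "norm v = 1" by auto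
  have vmax: "(A *v x) \<bullet> x \<le> (A *v v) \<bullet> v" if "x \<in> W" "norm x = 1" for x
    using vmax' that by simp
  define c where "c = (A *v v) \<bullet> v"
  \<comment> \<open>Homogeneous form of maximality: \<open>g\<close> is at most 0 on all of
    \<open>W\<close> and vanishes at \<open>v\<close>.\<close>
  define g where "g x = (A *v x) \<bullet> x - c * (x \<bullet> x)" for x
  have g_le: "g x \<le> 0" if x: "x \<in> W" for x
  proof (cases "x = 0")
    case False
    have "(A *v ((1 / norm x) *\<^sub>R x)) \<bullet> ((1 / norm x) *\<^sub>R x) \<le> c"
      unfolding c_def using x False by (intro vmax subspace_scale[OF W]) auto
    then have "((A *v x) \<bullet> x) / (norm x * norm x) \<le> c"
      by (simp add: matrix_vector_mult_scaleR)
    then show ?thesis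
      using False by (simp add: g_def field_simps dot_square_norm power2_eq_square)
  qed (simp add: g_def)
  \<comment> \<open>The residual of the eigenvector equation. It lies in \<open>W\<close>, and the
    slope of \<open>g\<close> at \<open>v\<close> in its direction is
    \<open>2 * (u \<bullet> u)\<close>, so maximality forces it to vanish.\<close>
  define u where "u = A *v v - c *\<^sub>R v"
  have u: "u \<in> W" unfolding u_def using v inv W by (intro subspace_diff subspace_scale) auto
  have "g (v + t *\<^sub>R u) = 2 * t * (u \<bullet> u) + t\<^sup>2 * g u" for t
  proof -
    have "(A *v u) \<bullet> v = u \<bullet> (A *v v)" by (rule self)
    moreover have "v \<bullet> v = 1" using v by (simp add: dot_square_norm)
    moreover have "u \<bullet> (A *v v) = u \<bullet> u + c * (u \<bullet> v)"
      by (subst (3) u_def) (simp add: inner_diff_right)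
    moreover have "(A *v v) \<bullet> u = u \<bullet> (A *v v)" "v \<bullet> u = u \<bullet> v"
      by (rule inner_commute)+
    ultimately show ?thesis
      by (simp add: g_def matrix_vector_right_distrib matrix_vector_mult_scaleR inner_add_left
          inner_add_right c_def[symmetric] algebra_simps power2_eq_square)
  qed
  then have le: "2 * t * (u \<bullet> u) + t\<^sup>2 * g u \<le> 0" for t
    using g_le[of "v + t *\<^sub>R u"] W u v by (simp add: subspace_add subspace_scale)
  have "u \<bullet> u = 0"
  proof (rule ccontr)
    assume "u \<bullet> u \<noteq> 0"
    then have uu: "u \<bullet> u > 0" by simp
    \<comment> \<open>So small that the linear term dominates the quadratic one; adding 1 keeps the
      denominator positive.\<close>
    define t where "t = (u \<bullet> u) / (\<bar>g u\<bar> + 1)"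
    have t: "t > 0" using uu by (simp add: t_def add_nonneg_pos)
    have "t * \<bar>g u\<bar> \<le> u \<bullet> u" using uu by (simp add: t_def divide_simps mult_left_mono)
    then have "2 * (u \<bullet> u) + t * g u > 0" using uu t abs_ge_minus_self[of "g u"]
      by (smt (verit) mult_left_mono minus_mult_right)
    then have "t * (2 * (u \<bullet> u) + t * g u) > 0" using t by simp
    with le[of t] show False by (simp add: algebra_simps power2_eq_square)
  qed
  then have "A *v v = c *\<^sub>R v" by (simp add: u_def)
  \<comment> \<open>Vectors of \<open>W\<close> are orthogonal to all eigenvectors, so
    \<open>v\<close> is orthogonal to itself.\<close>
  then have "v \<in> ?E" by blast
  with v have "v \<bullet> v = 0" by (auto simp: W_def)
  with v show False by simp
qed

text \<open>Only the zero vector can belong to the eigenvalue 0, and it satisfies the equation with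
  \<open>c = 1\<close> as well. Nonzero eigenvalues are wanted because they become frequencies with
  half period \<open>pi / \<bar>c\<bar>\<close>.\<close>

lemma invertible_symmetric_span_nonzero_eigenvectors:
  fixes A :: "real ^ 'd ^ 'd"
  assumes "transpose A = A" "invertible A"
  shows "span {v. \<exists>c. c \<noteq> 0 \<and> A *v v = c *\<^sub>R v} = UNIV"
proof -
  have "\<exists>c'. c' \<noteq> 0 \<and> A *v v = c' *\<^sub>R v" if "A *v v = c *\<^sub>R v" for v c
  proof (cases "c = 0")
    case True
    then have "A *v v = 0" using that by simp
    with assms(2) have "v = 0"
      by (metis invertible_def matrix_vector_mul_assoc matrix_vector_mul_lid matrix_vector_mult_0_right)
    then show ?thesis by (auto intro: exI[of _ 1])
  qed (use that in auto)
  then have "{v. \<exists>c. c \<noteq> 0 \<and> A *v v = c *\<^sub>R v} = {v. \<exists>c. A *v v = c *\<^sub>R v}" by blast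
  with symmetric_matrix_span_eigenvectors[OF assms(1)] show ?thesis by simp
qed

text \<open>Variation of constants after integration by parts: the forcing enters through the path
  \<open>b\<close> itself, not its derivative, and only \<open>y - b\<close> is
  differentiated.\<close>

lemma forced_oscillator:
  fixes x y b :: "real \<Rightarrow> real"
  assumes c: "c \<noteq> 0" and a: "a \<ge> 0" and b0: "b 0 = 0"
    and x: "\<And>r. r \<in> {0..a} \<Longrightarrow> (x has_real_derivative y r) (at r within {0..a})"
    and z: "\<And>r. r \<in> {0..a} \<Longrightarrow>
      ((\<lambda>r. y r - b r) has_real_derivative - (c\<^sup>2 * x r)) (at r within {0..a})"
  shows "x a = cos (c * a) * x 0 + sin (c * a) / c * y 0 + integral {0..a} (\<lambda>r. cos (c * (a - r)) * b r)"
    and "y a = - c * sin (c * a) * x 0 + cos (c * a) * y 0 + (b a - c * integral {0..a} (\<lambda>r. sin (c * (a - r)) * b r))"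
proof -
  define z where "z r = y r - b r" for r
  have y: "y r = z r + b r" for r by (simp add: z_def)
  note z' = z[folded z_def]
  \<comment> \<open>In the derivative of the bracket the terms with \<open>x\<close> cancel and
    \<open>y r - z r = b r\<close> remains; its end values give the position at \<open>a\<close> and
    the free oscillation.\<close>
  have "((\<lambda>r. cos (c * (a - r)) * b r) has_integral
      (cos (c * (a - a)) * x a + sin (c * (a - a)) / c * z a) -
      (cos (c * (a - 0)) * x 0 + sin (c * (a - 0)) / c * z 0)) {0..a}"
  proof (rule fundamental_theorem_of_calculus[OF a],
      unfold has_real_derivative_iff_has_vector_derivative[symmetric])
    fix r assume r: "r \<in> {0..a}"
    show "((\<lambda>r. cos (c * (a - r)) * x r + sin (c * (a - r)) / c * z r)
      has_real_derivative cos (c * (a - r)) * b r) (at r within {0..a})"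
      using c by (auto intro!: derivative_eq_intros x[OF r] z'[OF r] simp: y field_simps power2_eq_square)
  qed
  then show "x a = cos (c * a) * x 0 + sin (c * a) / c * y 0 + integral {0..a} (\<lambda>r. cos (c * (a - r)) * b r)"
    using b0 by (simp add: integral_unique z_def)
  have "((\<lambda>r. - c * (sin (c * (a - r)) * b r)) has_integral
      (- c * sin (c * (a - a)) * x a + cos (c * (a - a)) * z a) -
      (- c * sin (c * (a - 0)) * x 0 + cos (c * (a - 0)) * z 0)) {0..a}"
  proof (rule fundamental_theorem_of_calculus[OF a],
      unfold has_real_derivative_iff_has_vector_derivative[symmetric])
    fix r assume r: "r \<in> {0..a}"
    show "((\<lambda>r. - c * sin (c * (a - r)) * x r + cos (c * (a - r)) * z r)
      has_real_derivative - c * (sin (c * (a - r)) * b r)) (at r within {0..a})"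
      using c by (auto intro!: derivative_eq_intros x[OF r] z'[OF r] simp: y field_simps power2_eq_square)
  qed
  from integral_unique[OF this]
  show "y a = - c * sin (c * a) * x 0 + cos (c * a) * y 0 + (b a - c * integral {0..a} (\<lambda>r. sin (c * (a - r)) * b r))"
    using b0 by (simp add: z_def)
qed

section \<open>Cancellation of free oscillations by half-period shifts\<close>

text \<open>A list keeps multiplicities: summing the shifts of a function over it amounts to adding
  to the function its shift by \<open>h\<close>, successively for each entry
  \<open>h\<close>.\<close>

primrec subset_sums :: "real list \<Rightarrow> real list" where
  "subset_sums [] = [0]"
| "subset_sums (h # hs) = subset_sums hs @ map ((+) h) (subset_sums hs)"

lemma subset_sums_bounds:
  "(\<And>h. h \<in> set hs \<Longrightarrow> 0 \<le> h) \<Longrightarrow> \<tau> \<in> set (subset_sums hs) \<Longrightarrow> 0 \<le> \<tau> \<and> \<tau> \<le> sum_list hs"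
  by (induction hs arbitrary: \<tau>) fastforce+

lemma subset_sums_nonempty: "subset_sums hs \<noteq> []"
  by (induction hs) auto

text \<open>A half-period shift reverses the sign of the cosine. The free phase is needed for the
  induction, where a shift by \<open>h\<close> turns into the phase \<open>c * h\<close>; it also
  covers the sine.\<close>

lemma sum_list_subset_sums_cos_eq_0:
  assumes c: "c \<noteq> 0"
  shows "pi / \<bar>c\<bar> \<in> set hs \<Longrightarrow> (\<Sum>\<tau>\<leftarrow>subset_sums hs. cos (c * \<tau> + \<phi>)) = 0"
proof (induction hs arbitrary: \<phi>)
  case (Cons h hs)
  have split: "(\<Sum>\<tau>\<leftarrow>subset_sums (h # hs). cos (c * \<tau> + \<phi>))
      = (\<Sum>\<tau>\<leftarrow>subset_sums hs. cos (c * \<tau> + \<phi>)) + (\<Sum>\<tau>\<leftarrow>subset_sums hs. cos (c * \<tau> + (\<phi> + c * h)))"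
    by (simp add: o_def algebra_simps)
  show ?case
  proof (cases "pi / \<bar>c\<bar> = h")
    case True
    have "c * h = pi \<or> c * h = - pi" using c True by (auto simp: abs_if)
    then have "cos (c * \<tau> + (\<phi> + c * h)) = - cos (c * \<tau> + \<phi>)" for \<tau>
      by (auto simp: add.assoc[symmetric] cos_diff cos_add)
    then show ?thesis unfolding split by (simp add: uminus_sum_list_map[unfolded o_def, symmetric])
  next
    case False
    then show ?thesis unfolding split using Cons by simp
  qed
qed simp

lemma sum_list_subset_sums_oscillation_eq_0:
  assumes c: "c \<noteq> 0" and hs: "pi / \<bar>c\<bar> \<in> set hs"
  shows "(\<Sum>\<tau>\<leftarrow>subset_sums hs. cos (c * \<tau>) * p + sin (c * \<tau>) * q) = 0"
proof -
  have "(\<Sum>\<tau>\<leftarrow>subset_sums hs. cos (c * \<tau>)) = 0"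
    using sum_list_subset_sums_cos_eq_0[OF assms, of 0] by simp
  moreover have "(\<Sum>\<tau>\<leftarrow>subset_sums hs. sin (c * \<tau>)) = 0"
    using sum_list_subset_sums_cos_eq_0[OF assms, of "- pi / 2"] by (simp add: cos_diff)
  ultimately show ?thesis
    by (simp add: sum_list_addf sum_list_mult_const)
qed

subsection \<open>Components of the coupled oscillator\<close>

definition upper_block :: "'a ^ ('p::finite + 'q::finite) \<Rightarrow> 'a ^ 'p" where
  "upper_block z = (\<chi> i. z $ Inl i)"

definition lower_block :: "'a ^ ('p::finite + 'q::finite) \<Rightarrow> 'a ^ 'q" where
  "lower_block z = (\<chi> i. z $ Inr i)"

lemma sum_UNIV_Plus:
  "(\<Sum>k\<in>UNIV. f k) = (\<Sum>i\<in>UNIV. f (Inl i)) + (\<Sum>i\<in>UNIV. f (Inr i))"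
  for f :: "('p::finite + 'q::finite) \<Rightarrow> 'a::comm_monoid_add"
  by (simp add: UNIV_Plus_UNIV[symmetric] sum.Plus del: UNIV_Plus_UNIV)

lemma inner_block_vec:
  fixes u :: "real ^ 'p" and v :: "real ^ 'q"
  shows "block_vec u v \<bullet> z = u \<bullet> upper_block z + v \<bullet> lower_block z"
  by (simp add: inner_vec_def sum_UNIV_Plus block_vec_def upper_block_def lower_block_def)

lemma block_mat_mult:
  fixes A :: "real ^ 'm ^ 'p" and B :: "real ^ 'n ^ 'p"
  shows "upper_block (block_mat A B C D *v z) = A *v upper_block z + B *v lower_block z"
    and "lower_block (block_mat A B C D *v z) = C *v upper_block z + D *v lower_block z"
  by (simp_all add: vec_eq_iff matrix_vector_mult_def sum_UNIV_Plus block_mat_def block_vec_def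
      upper_block_def lower_block_def)

lemma block_col_mult:
  fixes A :: "real ^ 'n ^ 'p"
  shows "upper_block (block_col A B *v z) = A *v z"
    and "lower_block (block_col A B *v z) = B *v z"
  by (simp_all add: vec_eq_iff matrix_vector_mult_def block_col_def upper_block_def lower_block_def)

text \<open>Pairing both blocks with an eigenvector gives a scalar forced oscillator: by symmetry
  \<open>A ** A\<close> acts as \<open>c\<^sup>2\<close>, and the forcing becomes
  \<open>(transpose P *v v) \<bullet> f t\<close>.\<close>

lemma oscillator_eigencomponents:
  fixes A :: "real ^ 'd ^ 'd" and Z :: "real \<Rightarrow> real ^ ('d + 'd)" and f :: "real \<Rightarrow> real ^ 'm"
  assumes a: "a \<ge> 0" and Z: "continuous_on {0..a} Z" and f0: "f 0 = 0"
    and eq: "\<And>t. t \<in> {0..a} \<Longrightarrow> Z t = Z 0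
      + integral {0..t} (\<lambda>s. block_mat 0 (mat 1) (- (A ** A)) 0 *v Z s) + block_col 0 P *v f t"
    and A: "transpose A = A" and v: "A *v v = c *\<^sub>R v" and c: "c \<noteq> 0"
  shows "v \<bullet> upper_block (Z a) = cos (c * a) * (v \<bullet> upper_block (Z 0)) +
      sin (c * a) / c * (v \<bullet> lower_block (Z 0)) +
      integral {0..a} (\<lambda>r. cos (c * (a - r)) * ((transpose P *v v) \<bullet> f r))"
    and "v \<bullet> lower_block (Z a) = - c * sin (c * a) * (v \<bullet> upper_block (Z 0)) +
      cos (c * a) * (v \<bullet> lower_block (Z 0)) + ((transpose P *v v) \<bullet> f a -
      c * integral {0..a} (\<lambda>r. sin (c * (a - r)) * ((transpose P *v v) \<bullet> f r)))"
proof -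
  let ?M = "block_mat 0 (mat 1) (- (A ** A)) 0" and ?G = "block_col 0 P"
  have cont: "continuous_on {0..a} (\<lambda>s. ?M *v Z s)"
    by (rule bounded_linear.continuous_on[OF matrix_vector_mul_bounded_linear Z])
  \<comment> \<open>The driving path may be nowhere differentiable; subtracting its contribution
    leaves an integral with continuous integrand.\<close>
  have D: "((\<lambda>t. Z t - ?G *v f t) has_vector_derivative ?M *v Z r) (at r within {0..a})"
    if r: "r \<in> {0..a}" for r
  proof -
    have "((\<lambda>t. Z 0 + integral {0..t} (\<lambda>s. ?M *v Z s)) has_vector_derivative ?M *v Z r)
        (at r within {0..a})"
      using has_vector_derivative_add[OF has_vector_derivative_const
          integral_has_vector_derivative[OF cont r], of "Z 0"] by simp
    then show ?thesis
      by (rule has_vector_derivative_transform[OF r, rotated]) (simp only: diff_eq_eq eq[symmetric])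
  qed
  have inner_D: "((\<lambda>t. q \<bullet> (Z t - ?G *v f t)) has_real_derivative q \<bullet> (?M *v Z r)) (at r within {0..a})"
    if "r \<in> {0..a}" for r q
    unfolding has_real_derivative_iff_has_vector_derivative
    by (rule bounded_linear.has_vector_derivative[OF bounded_linear_inner_right D[OF that]])
  have self: "v \<bullet> (A *v z) = (A *v v) \<bullet> z" for z
    by (metis dot_lmul_matrix A vector_transpose_matrix)
  have P: "v \<bullet> (P *v z) = (transpose P *v v) \<bullet> z" for z
    by (metis dot_lmul_matrix transpose_matrix_vector)
  have neg: "(- B) *v z = - (B *v z)" for B :: "real ^ 'd ^ 'd" and z
    by (simp add: vec_eq_iff matrix_vector_mult_def sum_negf)
  have AA: "v \<bullet> ((- (A ** A)) *v z) = - (c\<^sup>2 * (v \<bullet> z))" for z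
    by (simp add: matrix_vector_mul_assoc[symmetric] self v power2_eq_square
        neg)
  have D1: "((\<lambda>t. v \<bullet> upper_block (Z t)) has_real_derivative v \<bullet> lower_block (Z r)) (at r within {0..a})"
    if "r \<in> {0..a}" for r
    using inner_D[OF that, of "block_vec v 0"]
    by (simp add: inner_diff_right inner_block_vec block_mat_mult block_col_mult)
  have D2: "((\<lambda>t. v \<bullet> lower_block (Z t) - (transpose P *v v) \<bullet> f t) has_real_derivative
      - (c\<^sup>2 * (v \<bullet> upper_block (Z r)))) (at r within {0..a})"
    if "r \<in> {0..a}" for r
    using inner_D[OF that, of "block_vec 0 v"]
    by (simp add: inner_diff_right inner_block_vec block_mat_mult block_col_mult AA P)
  note * = forced_oscillator[where b = "\<lambda>t. (transpose P *v v) \<bullet> f t", OF c a _ D1 D2]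
  show "v \<bullet> upper_block (Z a) = cos (c * a) * (v \<bullet> upper_block (Z 0)) +
      sin (c * a) / c * (v \<bullet> lower_block (Z 0)) +
      integral {0..a} (\<lambda>r. cos (c * (a - r)) * ((transpose P *v v) \<bullet> f r))"
    by (rule *(1)) (use f0 in auto)
  show "v \<bullet> lower_block (Z a) = - c * sin (c * a) * (v \<bullet> upper_block (Z 0)) +
      cos (c * a) * (v \<bullet> lower_block (Z 0)) + ((transpose P *v v) \<bullet> f a -
      c * integral {0..a} (\<lambda>r. sin (c * (a - r)) * ((transpose P *v v) \<bullet> f r)))"
    by (rule *(2)) (use f0 in auto)
qed

lemma sum_list_sum_swap:
  "(\<Sum>x\<leftarrow>xs. \<Sum>v\<in>S. g x v) = (\<Sum>v\<in>S. \<Sum>x\<leftarrow>xs. g x v)"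
  for g :: "'a \<Rightarrow> 'b \<Rightarrow> 'c::comm_monoid_add"
  by (induction xs) (auto simp: sum.distrib)

text \<open>The shifts and the functional are fixed before \<open>Z\<close> and \<open>f\<close>,
  hence independent of path and initial data; this lets one \<open>\<Phi>\<close> serve all
  windows.\<close>

lemma oscillator_component_subset_sums:
  fixes A :: "real ^ 'd ^ 'd" and P :: "real ^ 'm ^ 'd" and k :: "'d + 'd"
  assumes A: "transpose A = A" "invertible A"
  obtains hs and \<Phi> :: "(real \<Rightarrow> real ^ 'm) \<Rightarrow> real"
  where "\<And>h. h \<in> set hs \<Longrightarrow> h > 0" "hs \<noteq> []" "limit_of_evaluations (sum_list hs) \<Phi>"
    "\<And>Z f. \<lbrakk>continuous_on {0..sum_list hs} Z; f 0 = 0;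
      \<And>t. t \<in> {0..sum_list hs} \<Longrightarrow> Z t = Z 0
      + integral {0..t} (\<lambda>s. block_mat 0 (mat 1) (- (A ** A)) 0 *v Z s) + block_col 0 P *v f t\<rbrakk>
      \<Longrightarrow> (\<Sum>\<tau>\<leftarrow>subset_sums hs. Z \<tau> $ k) = \<Phi> f"
proof -
  define i where "i = (case k of Inl i \<Rightarrow> i | Inr i \<Rightarrow> i)"
  \<comment> \<open>A component is the pairing of a block with a unit vector, which is expanded into
    eigenvectors.\<close>
  have "axis i 1 \<in> span {v. \<exists>c. c \<noteq> 0 \<and> A *v v = c *\<^sub>R v}"
    using invertible_symmetric_span_nonzero_eigenvectors[OF A] by simp
  then obtain S u where S: "finite S" "S \<subseteq> {v. \<exists>c. c \<noteq> 0 \<and> A *v v = c *\<^sub>R v}"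
    and axis: "axis i 1 = (\<Sum>v\<in>S. u v *\<^sub>R v)"
    unfolding span_explicit by blast
  from S(2) have "\<forall>v\<in>S. \<exists>c. c \<noteq> 0 \<and> A *v v = c *\<^sub>R v" by blast
  then obtain c where c: "\<And>v. v \<in> S \<Longrightarrow> c v \<noteq> 0" "\<And>v. v \<in> S \<Longrightarrow> A *v v = c v *\<^sub>R v"
    by metis
  obtain vs where vs: "set vs = S" using finite_list[OF S(1)] by blast
  \<comment> \<open>The extra shift \<open>1\<close> only serves to make the list evidently nonempty.\<close>
  define hs where "hs = 1 # map (\<lambda>v. pi / \<bar>c v\<bar>) vs"
  have hs: "h \<in> set hs \<Longrightarrow> h > 0" for h
    using vs c by (auto simp: hs_def)
  have hs_c: "pi / \<bar>c v\<bar> \<in> set hs" if "v \<in> S" for v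
    using that vs by (auto simp: hs_def)
  have \<tau>: "0 \<le> \<tau>" "\<tau> \<le> sum_list hs" if "\<tau> \<in> set (subset_sums hs)" for \<tau>
    using subset_sums_bounds[OF _ that] hs by (auto intro: less_imp_le)
  let ?p = "\<lambda>v. transpose P *v v"
  \<comment> \<open>The forced part of the eigencomponent at time \<open>\<tau>\<close>: position
    for \<open>Inl\<close>, velocity for \<open>Inr\<close>.\<close>
  define \<Psi> where "\<Psi> = (\<lambda>v \<tau> f. case k of
      Inl _ \<Rightarrow> integral {0..\<tau>} (\<lambda>r. cos (c v * (\<tau> - r)) * (?p v \<bullet> f r))
    | Inr _ \<Rightarrow> ?p v \<bullet> f \<tau> - c v * integral {0..\<tau>} (\<lambda>r. sin (c v * (\<tau> - r)) * (?p v \<bullet> f r)))"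
  have \<Psi>: "limit_of_evaluations (sum_list hs) (\<Psi> v \<tau>)" if "\<tau> \<in> set (subset_sums hs)" for v \<tau>
    using \<tau>[OF that] unfolding \<Psi>_def
    by (cases k)
      (auto intro!: limit_of_evaluations_integral limit_of_evaluations_diff
        limit_of_evaluations_eval limit_of_evaluations_cmult continuous_intros)
  define \<Phi> where "\<Phi> = (\<lambda>f. \<Sum>v\<in>S. u v * (\<Sum>\<tau>\<leftarrow>subset_sums hs. \<Psi> v \<tau> f))"
  show ?thesis
  proof (rule that[OF hs])
    show "hs \<noteq> []" by (simp add: hs_def)
    show "limit_of_evaluations (sum_list hs) \<Phi>" unfolding \<Phi>_def
      by (intro limit_of_evaluations_sum S limit_of_evaluations_cmult limit_of_evaluations_sum_list \<Psi>)
    fix Z f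
    assume Z: "continuous_on {0..sum_list hs} Z" and f0: "f 0 = 0"
      and eq: "\<And>t. t \<in> {0..sum_list hs} \<Longrightarrow> Z t = Z 0
      + integral {0..t} (\<lambda>s. block_mat 0 (mat 1) (- (A ** A)) 0 *v Z s) + block_col 0 P *v f t"
    define B :: "real ^ ('d + 'd) \<Rightarrow> real ^ 'd"
      where "B = (\<lambda>z. case k of Inl _ \<Rightarrow> upper_block z | Inr _ \<Rightarrow> lower_block z)"
    have zk: "z $ k = (\<Sum>v\<in>S. u v * (v \<bullet> B z))" for z
    proof -
      have "z $ k = axis i 1 \<bullet> B z"
        by (cases k) (auto simp: i_def B_def inner_axis' upper_block_def lower_block_def)
      then show ?thesis by (simp add: axis inner_sum_left)
    qed
    \<comment> \<open>All initial data sit in \<open>p\<close> and \<open>q\<close>, which are the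
      same for every shift \<open>\<tau>\<close>; summation over the shifts therefore removes
      them.\<close>
    have osc: "\<exists>p q. \<forall>\<tau>\<in>set (subset_sums hs).
        v \<bullet> B (Z \<tau>) = (cos (c v * \<tau>) * p + sin (c v * \<tau>) * q) + \<Psi> v \<tau> f" if v: "v \<in> S" for v
    proof -
      have *: "v \<bullet> upper_block (Z \<tau>) = cos (c v * \<tau>) * (v \<bullet> upper_block (Z 0)) +
          sin (c v * \<tau>) / c v * (v \<bullet> lower_block (Z 0)) +
          integral {0..\<tau>} (\<lambda>r. cos (c v * (\<tau> - r)) * (?p v \<bullet> f r))" (is "?U \<tau>")
        "v \<bullet> lower_block (Z \<tau>) = - c v * sin (c v * \<tau>) * (v \<bullet> upper_block (Z 0)) +
          cos (c v * \<tau>) * (v \<bullet> lower_block (Z 0)) + (?p v \<bullet> f \<tau> -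
          c v * integral {0..\<tau>} (\<lambda>r. sin (c v * (\<tau> - r)) * (?p v \<bullet> f r)))" (is "?L \<tau>")
        if \<tau>_in: "\<tau> \<in> set (subset_sums hs)" for \<tau>
      proof -
        have sub: "{0..\<tau>} \<subseteq> {0..sum_list hs}" using \<tau>[OF \<tau>_in] by auto
        note sol = oscillator_eigencomponents[OF \<tau>(1)[OF \<tau>_in] continuous_on_subset[OF Z sub] f0
            eq[OF subsetD[OF sub]] A(1) c(2)[OF v] c(1)[OF v]]
        show "?U \<tau>" by (rule sol(1))
        show "?L \<tau>" by (rule sol(2))
      qed
      show ?thesis
      proof (cases k)
        case Inl
        then show ?thesis
          by (intro exI[of _ "v \<bullet> upper_block (Z 0)"] exI[of _ "(v \<bullet> lower_block (Z 0)) / c v"] ballI)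
            (drule *(1), simp add: B_def \<Psi>_def)
      next
        case Inr
        then show ?thesis
          by (intro exI[of _ "v \<bullet> lower_block (Z 0)"] exI[of _ "- c v * (v \<bullet> upper_block (Z 0))"] ballI)
            (drule *(2), simp add: B_def \<Psi>_def)
      qed
    qed
    have "(\<Sum>\<tau>\<leftarrow>subset_sums hs. v \<bullet> B (Z \<tau>)) = (\<Sum>\<tau>\<leftarrow>subset_sums hs. \<Psi> v \<tau> f)" if v: "v \<in> S" for v
    proof -
      obtain p q where pq: "\<And>\<tau>. \<tau> \<in> set (subset_sums hs) \<Longrightarrow>
          v \<bullet> B (Z \<tau>) = (cos (c v * \<tau>) * p + sin (c v * \<tau>) * q) + \<Psi> v \<tau> f"
        using osc[OF v] by blast
      have "(\<Sum>\<tau>\<leftarrow>subset_sums hs. v \<bullet> B (Z \<tau>))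
        = (\<Sum>\<tau>\<leftarrow>subset_sums hs. (cos (c v * \<tau>) * p + sin (c v * \<tau>) * q) + \<Psi> v \<tau> f)"
        by (intro arg_cong[where f=sum_list] map_cong refl pq)
      also have "\<dots> = (\<Sum>\<tau>\<leftarrow>subset_sums hs. \<Psi> v \<tau> f)"
        using sum_list_subset_sums_oscillation_eq_0[OF c(1)[OF v] hs_c[OF v], of p q]
        by (subst sum_list_addf) simp
      finally show ?thesis .
    qed
    then show "(\<Sum>\<tau>\<leftarrow>subset_sums hs. Z \<tau> $ k) = \<Phi> f"
      by (simp add: zk \<Phi>_def sum_list_sum_swap sum_list_const_mult)
  qed
qed

subsection \<open>Almost sure sign changes\<close>

text \<open>A positive limit makes the approximants positive from some index on, so the probability
  bound for finite combinations can be transferred to \<open>\<Phi>\<close>.\<close>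

lemma standard_wiener_functional_not_always_pos:
  fixes w :: "real \<Rightarrow> 'w \<Rightarrow> real ^ 'm"
  assumes M: "prob_space M" and w: "standard_wiener M w"
    and s: "s \<ge> 0" and L: "L > 0" and \<Phi>: "limit_of_evaluations L \<Phi>"
  shows "AE \<omega> in M. \<not> (\<forall>n. \<Phi> (\<lambda>r. w (s + real n * L + r) \<omega> - w (s + real n * L) \<omega>) > 0)"
proof -
  interpret prob_space M by fact
  let ?s = "\<lambda>n. s + real n * L"
  have sn: "?s n \<ge> 0" for n using s L by simp
  from \<Phi> obtain xs where xs: "\<And>N. fst ` set (xs N) \<subseteq> {0..L}"
    and lim: "\<And>f. continuous_on {0..L} f \<Longrightarrow> (\<lambda>N. \<Sum>(r, b)\<leftarrow>xs N. b \<bullet> f r) \<longlonglongrightarrow> \<Phi> f"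
    unfolding limit_of_evaluations_def by metis
  let ?f = "\<lambda>n \<omega> r. w (?s n + r) \<omega> - w (?s n) \<omega>"
  define V where "V N n \<omega> = (\<Sum>(r, b)\<leftarrow>xs N. b \<bullet> ?f n \<omega> r)" for N n \<omega>
  have [measurable]: "w t \<in> borel_measurable M" if "t \<ge> 0" for t
    using w that by (auto simp: standard_wiener_def)
  have "(\<lambda>\<omega>. \<Sum>(r, b)\<leftarrow>ys. b \<bullet> ?f n \<omega> r) \<in> borel_measurable M"
    if "fst ` set ys \<subseteq> {0..L}" for ys n
    using that
  proof (induction ys)
    case (Cons a ys)
    then have "?s n + fst a \<ge> 0" using sn[of n] by simp
    then show ?case using Cons sn[of n] by (auto simp: case_prod_unfold)
  qed simp
  then have [measurable]: "V N n \<in> borel_measurable M" for N n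
    using xs[of N] unfolding V_def by blast
  define D where "D m N0 = {\<omega> \<in> space M. \<forall>N\<ge>N0. \<forall>n<m. V N n \<omega> > 0}" for m N0
  have D[measurable]: "D m N0 \<in> sets M" for m N0
    unfolding D_def by measurable
  have D_le: "prob (D m N0) \<le> (1/2) ^ m" for m N0
  proof -
    have "prob (D m N0) \<le> prob {\<omega> \<in> space M. \<forall>n<m. V N0 n \<omega> > 0}"
      by (intro finite_measure_mono) (auto simp: D_def)
    also have "\<dots> \<le> (1/2) ^ m"
      unfolding V_def by (rule standard_wiener_blocks_pos_le[OF M w s L xs])
    finally show ?thesis .
  qed
  \<comment> \<open>\<open>D m N0\<close> grows with \<open>N0\<close>, so continuity from below
    carries the bound, uniform in \<open>N0\<close>, over to the union.\<close>
  have UN_le: "prob (\<Union>N0. D m N0) \<le> (1/2) ^ m" for m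
  proof (rule LIMSEQ_le_const2)
    show "(\<lambda>N0. prob (D m N0)) \<longlonglongrightarrow> prob (\<Union>N0. D m N0)"
      by (rule finite_Lim_measure_incseq) (auto simp: incseq_def D_def)
  qed (use D_le in auto)
  \<comment> \<open>This event is measurable by construction, and a continuous path with all values
    of \<open>\<Phi>\<close> positive belongs to it.\<close>
  let ?E = "\<Inter>m. \<Union>N0. D m N0"
  have "prob ?E \<le> (1/2) ^ m" for m
    by (rule order_trans[OF finite_measure_mono UN_le[of m]]) auto
  moreover have "(\<lambda>m. (1/2 :: real) ^ m) \<longlonglongrightarrow> 0"
    by (rule LIMSEQ_power_zero) simp
  ultimately have "prob ?E \<le> 0"
    by (intro LIMSEQ_le_const[of "\<lambda>m. (1/2) ^ m"]) auto
  then have "prob ?E = 0"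
    using measure_nonneg[of M ?E] by linarith
  then have "AE \<omega> in M. \<omega> \<notin> ?E"
    by (subst (asm) prob_eq_0) auto
  moreover have "AE \<omega> in M. continuous_on {0..} (\<lambda>t. w t \<omega>)"
    using w by (auto simp: standard_wiener_def)
  ultimately show ?thesis
    using AE_space
  proof eventually_elim
    case (elim \<omega>)
    show ?case
    proof
      assume pos: "\<forall>n. \<Phi> (?f n \<omega>) > 0"
      have "eventually (\<lambda>N. V N n \<omega> > 0) sequentially" for n
      proof -
        have "continuous_on {0..L} (?f n \<omega>)"
          using sn[of n] by (intro continuous_intros continuous_on_compose2[OF elim(2)]) auto
        from lim[OF this] have "(\<lambda>N. V N n \<omega>) \<longlonglongrightarrow> \<Phi> (?f n \<omega>)"
          unfolding V_def .
        then show ?thesis using pos by (auto intro: order_tendstoD)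
      qed
      \<comment> \<open>Finitely many windows have a common threshold, which is why \<open>D\<close>
        looks at the first \<open>m\<close> of them only.\<close>
      then have "eventually (\<lambda>N. \<forall>n\<in>{..<m}. V N n \<omega> > 0) sequentially" for m
        by (intro eventually_ball_finite) auto
      then have "\<exists>N0. \<omega> \<in> D m N0" for m
        using elim(3) unfolding D_def eventually_sequentially by fastforce
      with elim(1) show False by auto
    qed
  qed
qed

section \<open>From finitely many zeros to a contradiction\<close>

lemma eventually_constant_sign:
  fixes g :: "real \<Rightarrow> real"
  assumes g: "continuous_on {t0..} g" and fin: "finite {t. t \<ge> t0 \<and> g t = 0}"
  obtains T where "T \<ge> t0" "(\<forall>t\<ge>T. g t > 0) \<or> (\<forall>t\<ge>T. g t < 0)"
proof -
  let ?Z = "{t. t \<ge> t0 \<and> g t = 0}"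
  \<comment> \<open>Inserting \<open>t0\<close> makes the set nonempty and gives
    \<open>T \<ge> t0\<close>; adding 1 goes strictly beyond the last zero.\<close>
  define T where "T = Max (insert t0 ?Z) + 1"
  have T: "t < T" if "t \<in> insert t0 ?Z" for t
    using Max_ge[of "insert t0 ?Z", OF _ that] fin by (simp add: T_def)
  then have T0: "T \<ge> t0" by (simp add: less_imp_le)
  have nz: "g t \<noteq> 0" if "t \<ge> T" for t
    using T[of t] that T0 by force
  have conn: "connected (g ` {T..})"
    using T0 by (intro connected_continuous_image continuous_on_subset[OF g]) auto
  have "(\<forall>t\<ge>T. g t > 0) \<or> (\<forall>t\<ge>T. g t < 0)"
  proof (rule ccontr)
    assume "\<not> ?thesis"
    then obtain a b where ab: "a \<ge> T" "g a \<le> 0" "b \<ge> T" "g b \<ge> 0"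
      by (auto simp: not_less)
    then have "0 \<in> g ` {T..}"
      using connectedD_interval[OF conn, of "g a" "g b" 0] by simp
    with nz show False by force
  qed
  with T0 show thesis by (rule that)
qed

lemma sum_list_pos:
  "xs \<noteq> [] \<Longrightarrow> (\<And>x. x \<in> set xs \<Longrightarrow> f x > 0) \<Longrightarrow> (\<Sum>x\<leftarrow>xs. f x) > 0"
  for f :: "'a \<Rightarrow> real"
  using sum_list_strict_mono[of xs "\<lambda>_. 0" f] by simp

text \<open>The equation at \<open>s\<close> is subtracted from the one at \<open>s + t\<close>.
  Every window thus carries a solution of the same equation, driven by increments from the window
  start.\<close>

lemma linear_integral_equation_restart:
  fixes A :: "real ^ 'n ^ 'n" and G :: "real ^ 'm ^ 'n" and x :: "real \<Rightarrow> real ^ 'n"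
  assumes x: "continuous_on {t0..} x"
    and eq: "\<And>t. t \<ge> t0 \<Longrightarrow> x t = x t0 + integral {t0..t} (\<lambda>s. A *v x s) + G *v (w t - w t0)"
    and s: "s \<ge> t0" and t: "t \<ge> 0"
  shows "x (s + t) = x s + integral {0..t} (\<lambda>r. A *v x (s + r)) + G *v (w (s + t) - w s)"
proof -
  let ?h = "\<lambda>r. A *v x r"
  have cont: "continuous_on {t0..} ?h"
    by (rule bounded_linear.continuous_on[OF matrix_vector_mul_bounded_linear x])
  have split: "integral {t0..s + t} ?h = integral {t0..s} ?h + integral {s..s + t} ?h"
    using s t by (intro Henstock_Kurzweil_Integration.integral_combine[symmetric]
        integrable_continuous_real continuous_on_subset[OF cont]) auto
  have shift: "integral {0..t} (\<lambda>r. ?h (s + r)) = integral {s..s + t} ?h"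
    using integral_shift_Icc_real[of 0 t ?h s] by (simp add: o_def add.commute)
  have G: "G *v (w (s + t) - w s) = G *v (w (s + t) - w t0) - G *v (w s - w t0)"
    by (simp add: matrix_vector_mult_diff_distrib)
  have "x (s + t) = x t0 + integral {t0..s + t} ?h + G *v (w (s + t) - w t0)"
    using s t by (intro eq) simp
  then show ?thesis
    unfolding split shift G eq[OF s] by simp
qed

theorem theorem2:
  fixes M :: "'w measure"
    and F :: "real \<Rightarrow> 'w measure"
    and w :: "real \<Rightarrow> 'w \<Rightarrow> real ^ 'm"
    and \<Lambda> :: "real ^ 'd ^ 'd"
    and P :: "real ^ 'm ^ 'd"
    and t0 :: real
    and x0 y0 :: "real ^ 'd"
    and X :: "real \<Rightarrow> 'w \<Rightarrow> real ^ ('d + 'd)"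
  assumes "prob_space M"
    and "complete_measure M"
    and "t0 \<ge> 0"
    and "filtration_from M t0 F"
    and "wiener_wrt M t0 F w"
    and "CARD('d) > 1"
    and "invertible \<Lambda>"
    and "transpose \<Lambda> = \<Lambda>"
    and "linear_sde_solution M t0 F w
           (block_mat 0 (mat 1) (- (\<Lambda> ** \<Lambda>)) 0) (block_col 0 P) X"
    and "AE \<omega> in M. X t0 \<omega> = block_vec x0 y0"
  shows "AE \<omega> in M. \<forall>k. infinite {t. t \<ge> t0 \<and> X t \<omega> $ k = 0}"
proof -
  let ?A = "block_mat 0 (mat 1) (- (\<Lambda> ** \<Lambda>)) 0 :: real ^ ('d + 'd) ^ ('d + 'd)"
  let ?G = "block_col 0 P :: real ^ 'm ^ ('d + 'd)"
  have w: "standard_wiener M w" using assms(5) by (simp add: wiener_wrt_def)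
  have X: "AE \<omega> in M. continuous_on {t0..} (\<lambda>t. X t \<omega>)"
    "AE \<omega> in M. \<forall>t\<ge>t0. X t \<omega> = X t0 \<omega> + integral {t0..t} (\<lambda>s. ?A *v X s \<omega>) + ?G *v (w t \<omega> - w t0 \<omega>)"
    using assms(9) by (auto simp: linear_sde_solution_def)
  have "AE \<omega> in M. infinite {t. t \<ge> t0 \<and> X t \<omega> $ k = 0}" for k
  proof -
    obtain hs and \<Phi> :: "(real \<Rightarrow> real ^ 'm) \<Rightarrow> real"
      where hs: "\<And>h. h \<in> set hs \<Longrightarrow> h > 0" "hs \<noteq> []" and \<Phi>: "limit_of_evaluations (sum_list hs) \<Phi>"
      and rep: "\<And>Z f. \<lbrakk>continuous_on {0..sum_list hs} Z; f 0 = 0;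
      \<And>t. t \<in> {0..sum_list hs} \<Longrightarrow> Z t = Z 0 + integral {0..t} (\<lambda>s. ?A *v Z s) + ?G *v f t\<rbrakk>
      \<Longrightarrow> (\<Sum>\<tau>\<leftarrow>subset_sums hs. Z \<tau> $ k) = \<Phi> f"
      by (rule oscillator_component_subset_sums[OF assms(8,7), where k = k and P = P]) blast
    let ?L = "sum_list hs"
    have L: "?L > 0" using sum_list_pos[of hs "\<lambda>h. h"] hs by simp
    \<comment> \<open>The time after which the sign is constant depends on \<open>\<omega>\<close>,
      so the null set must serve all of the countably many starting windows \<open>n0\<close> at
      once.\<close>
    have sgn: "AE \<omega> in M. \<forall>n0. \<not> (\<forall>n. \<Psi> (\<lambda>r. w ((t0 + real n0 * ?L) + real n * ?L + r) \<omega>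
        - w ((t0 + real n0 * ?L) + real n * ?L) \<omega>) > 0)"
      if "limit_of_evaluations ?L \<Psi>" for \<Psi>
      unfolding AE_all_countable using assms(3) L
      by (intro allI standard_wiener_functional_not_always_pos[OF assms(1) w _ L that]) simp
    \<comment> \<open>The negated functional handles components that are eventually
      negative.\<close>
    have "limit_of_evaluations ?L (\<lambda>f. - \<Phi> f)"
      using limit_of_evaluations_cmult[OF \<Phi>, of "- 1"] by simp
    from sgn[OF this] sgn[OF \<Phi>] X show ?thesis
    proof eventually_elim
      case (elim \<omega>)
      show ?case
      proof
        assume "finite {t. t \<ge> t0 \<and> X t \<omega> $ k = 0}"
        with elim(3) obtain T where T: "T \<ge> t0"
          and TX: "(\<forall>t\<ge>T. X t \<omega> $ k > 0) \<or> (\<forall>t\<ge>T. X t \<omega> $ k < 0)"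
          by (rule_tac eventually_constant_sign[of t0 "\<lambda>t. X t \<omega> $ k"]) (auto intro!: continuous_intros)
        \<comment> \<open>Skipping \<open>n0\<close> windows moves all sampled times beyond
          \<open>T\<close>.\<close>
        obtain n0 :: nat where n0: "T - t0 \<le> real n0 * ?L"
          using ex_less_of_nat_mult[OF L, of "T - t0"] less_imp_le by blast
        let ?s = "\<lambda>n. (t0 + real n0 * ?L) + real n * ?L"
        let ?f = "\<lambda>n r. w (?s n + r) \<omega> - w (?s n) \<omega>"
        have sT: "?s n \<ge> T" for n
          using n0 L by (simp add: add_increasing2)
        have eq: "(\<Sum>\<tau>\<leftarrow>subset_sums hs. X (?s n + \<tau>) \<omega> $ k) = \<Phi> (?f n)" for n
        proof (rule rep)
          have s0: "?s n \<ge> t0" using sT[of n] T by simp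
          show "continuous_on {0..?L} (\<lambda>t. X (?s n + t) \<omega>)"
            using s0 by (intro continuous_on_compose2[OF elim(3)] continuous_intros) auto
          fix t assume t: "t \<in> {0..?L}"
          show "X (?s n + t) \<omega> = X (?s n + 0) \<omega> + integral {0..t} (\<lambda>r. ?A *v X (?s n + r) \<omega>) + ?G *v ?f n t"
            using linear_integral_equation_restart[OF elim(3) elim(4)[rule_format] s0, of t] t by simp
        qed simp
        have ge: "?s n + \<tau> \<ge> T" if "\<tau> \<in> set (subset_sums hs)" for n \<tau>
          using sT[of n] subset_sums_bounds[OF _ that] hs by (fastforce intro: less_imp_le)
        from TX show False
        proof
          assume "\<forall>t\<ge>T. X t \<omega> $ k > 0"
          then have "\<Phi> (?f n) > 0" for n
            unfolding eq[symmetric] using ge by (intro sum_list_pos subset_sums_nonempty) auto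
          with elim(2) show False by blast
        next
          assume "\<forall>t\<ge>T. X t \<omega> $ k < 0"
          then have "(\<Sum>\<tau>\<leftarrow>subset_sums hs. - (X (?s n + \<tau>) \<omega> $ k)) > 0" for n
            using ge by (intro sum_list_pos subset_sums_nonempty) auto
          then have "- \<Phi> (?f n) > 0" for n
            unfolding eq[symmetric] by (simp add: uminus_sum_list_map o_def)
          with elim(1) show False by blast
        qed
      qed
    qed
  qed
  \<comment> \<open>There are finitely many components, so their null sets can be merged.\<close>
  then show ?thesis by (rule eventually_all_finite)
qed

end
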